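(* Let $N\in\mathbb{N}$ and let $A\subset\mathbb{R}^N$ be a set that is not relatively compact in $\mathbb{R}^N$. Then the family $nBC^\infty I(A)=\{f\in X : f \text{ is unbounded in } A\}$ is infinitely pointwise $\mathfrak{c}$-lineable in $X$.
   Context: Let $X:=C^\infty(\mathbb{R}^N)\cap\bigcap_{p\ge 1}L^p(\mathbb{R}^N)$, i.e. the vector space of all infinitely differentiable functions $f:\mathbb{R}^N\to\mathbb{R}$ that are $p$-integrable (Lebesgue) on $\mathbb{R}^N$ for every real $p\in[1,+\infty)$. $\mathfrak{c}$ is the cardinality of the continuum; dimensions are algebraic (cardinality of a Hamel basis). For an infinite cardinal $\alpha$, a subset $M$ of a vector space $X$ is infinitely pointwise $\alpha$-lineable if for every $x\in M$ there exists a family $\{W_k\}_{k\in\mathbb{N}}$ of vector subspaces of $X$ such that for each $k\in\mathbb{N}$: (i) $\dim(W_k)=\alpha$; (ii) $x\in W_k\subset M\cup\{0\}$; (iii) $W_k\cap W_l=\mathrm{span}\{x\}$ for every $l\in\mathbb{N}$ with $l\neq k$. *)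

theory Defs
  imports "HOL-Analysis.Analysis" "HOL-Library.Function_Algebras"
begin

unbundle cardinal_syntax

instantiation "fun" :: (type, real_vector) real_vector
begin

definition scaleR_fun :: "real \<Rightarrow> ('a \<Rightarrow> 'b) \<Rightarrow> 'a \<Rightarrow> 'b"
  where "scaleR_fun c f = (\<lambda>x. c *\<^sub>R f x)"

instance
  by standard (simp_all add: scaleR_fun_def fun_eq_iff scaleR_add_right scaleR_add_left)

end

lemma scaleR_fun_apply [simp]: "(c *\<^sub>R f) x = c *\<^sub>R f x"
  by (simp add: scaleR_fun_def)

text \<open>
  \<open>has_dimension W \<alpha>\<close> says that the algebraic dimension of \<open>W\<close> is the cardinal \<open>\<alpha>\<close>. The library
  function \<^const>\<open>dim\<close> takes values in \<^typ>\<open>nat\<close> and cannot distinguish infinite dimensions.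
\<close>

definition has_dimension :: "'v::real_vector set \<Rightarrow> 'c rel \<Rightarrow> bool"
  where "has_dimension W \<alpha> \<longleftrightarrow> (\<exists>B. independent B \<and> span B = W \<and> |B| =o \<alpha>)"

text \<open>
  The ambient space \<open>V\<close> is a linear subspace of the type \<open>'v\<close>, so that the vector subspaces
  of \<open>V\<close> are the linear subspaces of \<open>'v\<close> contained in \<open>V\<close>. The first three conjuncts state the
  conditions on \<open>\<alpha>\<close>, \<open>V\<close> and \<open>M\<close> under which the notion is defined.
\<close>

definition infinitely_pointwise_lineable :: "'c rel \<Rightarrow> 'v::real_vector set \<Rightarrow> 'v set \<Rightarrow> bool"
  where "infinitely_pointwise_lineable \<alpha> V M \<longleftrightarrow>
    Cinfinite \<alpha> \<and> subspace V \<and> M \<subseteq> V \<and>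
    (\<forall>x\<in>M. \<exists>W :: nat \<Rightarrow> 'v set. \<forall>k.
      subspace (W k) \<and> W k \<subseteq> V \<and>
      has_dimension (W k) \<alpha> \<and>
      x \<in> W k \<and> W k \<subseteq> M \<union> {0} \<and>
      (\<forall>l. l \<noteq> k \<longrightarrow> W k \<inter> W l = span {x}))"

primrec k_times_cont_diff :: "nat \<Rightarrow> ('a::euclidean_space \<Rightarrow> real) \<Rightarrow> bool"
  where
    "k_times_cont_diff 0 f \<longleftrightarrow> continuous_on UNIV f"
  | "k_times_cont_diff (Suc k) f \<longleftrightarrow>
      (\<forall>x. f differentiable (at x)) \<and>
      (\<forall>i\<in>Basis. k_times_cont_diff k (\<lambda>x. frechet_derivative f (at x) i))"

definition smooth :: "('a::euclidean_space \<Rightarrow> real) \<Rightarrow> bool"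
  where "smooth f \<longleftrightarrow> (\<forall>k. k_times_cont_diff k f)"

definition p_integrable :: "real \<Rightarrow> ('a::euclidean_space \<Rightarrow> real) \<Rightarrow> bool"
  where "p_integrable p f \<longleftrightarrow>
    f \<in> borel_measurable lebesgue \<and> integrable lebesgue (\<lambda>x. \<bar>f x\<bar> powr p)"

text \<open>The elements of \<open>CinfI\<close> are functions, not classes modulo equality almost everywhere.\<close>

definition CinfI :: "('a::euclidean_space \<Rightarrow> real) set"
  where "CinfI = {f. smooth f \<and> (\<forall>p\<ge>1. p_integrable p f)}"

definition nBCinfI :: "'a::euclidean_space set \<Rightarrow> ('a \<Rightarrow> real) set"
  where "nBCinfI A = {f \<in> CinfI. \<not> bounded (f ` A)}"

definition relatively_compact :: "'a::topological_space set \<Rightarrow> bool"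
  where "relatively_compact A \<longleftrightarrow> compact (closure A)"

end

theory Submission
  imports Defs "HOL-Real_Asymp.Real_Asymp"
begin

text \<open>
  Let \<open>f\<close> be a smooth function that lies in every \<open>L\<^sup>p\<close> and is unbounded on \<open>A\<close>. Continuous functions
  are bounded on balls, so there are points \<open>a n\<close> of \<open>A\<close>, pairwise at distance at least 2, with
  \<open>\<bar>f (a n)\<bar> \<ge> n + 1\<close>. Put at each \<open>a n\<close> a smooth bump \<open>\<phi>\<^sub>n\<close> of height 1, supported in a ball of
  radius \<open>2\<^sup>-\<^sup>n\<^sup>-\<^sup>1\<close>. A sequence \<open>c\<close> then yields the smooth function \<open>bump_series c = \<Sum>n. c n * \<phi>\<^sub>n\<close>,
  which takes the value \<open>c n\<close> at \<open>a n\<close>. The volumes of the supports decay geometrically, so that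
  linear growth of \<open>c\<close> suffices for \<open>bump_series c\<close> to lie in every \<open>L\<^sup>p\<close>
  (\<open>bump_series_in_CinfI\<close>). The problem is thereby moved to a space of sequences.

  Arrange the indices in infinitely many infinite rows by the pairing function. In row \<open>k\<close> consider
  the sequences \<open>(j + 1) powr t\<close> for \<open>0 < t < 1\<close>, extended by 0 to the other rows. In a linear
  combination the largest exponent dominates, so a combination with a nonzero coefficient is unbounded
  (\<open>unbounded_power_seq_combination\<close>). Hence these sequences are linearly independent, and
  every nonzero element of their span, the row space, is unbounded.

  The subspace \<open>W k\<close> consists of the functions \<open>s *\<^sub>R f + bump_series c\<close> with \<open>c\<close> in the row space of
  \<open>k\<close>. If \<open>s \<noteq> 0\<close>, this function is unbounded on \<open>A\<close> because it equals \<open>s *\<^sub>R f\<close> at all points belonging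
  to any other row; if \<open>s = 0\<close>, it is unbounded because \<open>c\<close> is. A function in both \<open>W k\<close> and \<open>W l\<close> has the
  same coefficient \<open>s\<close> in both representations, as one sees at a point of a third row; the two
  sequences then coincide, and as they live in different rows they vanish.
\<close>

section \<open>Closure properties of smooth functions\<close>

text \<open>
  Differentiability of higher order is defined through \<^const>\<open>frechet_derivative\<close>, which is chosen by
  Hilbert's operator. An explicit derivative coincides with it by uniqueness, so the rules of
  calculus for \<open>has_derivative\<close> become available.
\<close>

lemma k_times_cont_diff_SucI:
  assumes "\<And>x. (f has_derivative f' x) (at x)"
    and "\<And>i. i \<in> Basis \<Longrightarrow> k_times_cont_diff k (\<lambda>x. f' x i)"
  shows "k_times_cont_diff (Suc k) f"
proof -
  have "frechet_derivative f (at x) = f' x" for x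
    using frechet_derivative_at[OF assms(1)] by simp
  then show ?thesis
    using assms by (auto simp: differentiable_def)
qed

lemma k_times_cont_diff_SucD:
  assumes "k_times_cont_diff (Suc k) f"
  shows "(f has_derivative frechet_derivative f (at x)) (at x)"
    and "i \<in> Basis \<Longrightarrow> k_times_cont_diff k (\<lambda>x. frechet_derivative f (at x) i)"
  using assms by (auto simp: frechet_derivative_works)

lemma k_times_cont_diff_Suc_imp: "k_times_cont_diff (Suc k) f \<Longrightarrow> k_times_cont_diff k f"
proof (induction k arbitrary: f)
  case 0
  then show ?case
    by (auto intro!: differentiable_imp_continuous_on simp: differentiable_on_def
        intro: differentiable_at_withinI)
next
  case (Suc k)
  show ?case
    by (rule k_times_cont_diff_SucI[OF k_times_cont_diff_SucD(1)[OF Suc.prems]])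
      (rule Suc.IH[OF k_times_cont_diff_SucD(2)[OF Suc.prems]])
qed

lemma k_times_cont_diff_const: "k_times_cont_diff k (\<lambda>x. c)"
proof (induction k arbitrary: c)
  case (Suc k)
  show ?case
    by (rule k_times_cont_diff_SucI[where f' = "\<lambda>x h. 0"]) (auto intro: Suc)
qed auto

lemma k_times_cont_diff_add:
  "k_times_cont_diff k f \<Longrightarrow> k_times_cont_diff k g \<Longrightarrow> k_times_cont_diff k (\<lambda>x. f x + g x)"
proof (induction k arbitrary: f g)
  case 0
  then show ?case by (auto intro: continuous_intros)
next
  case (Suc k)
  show ?case
    by (rule k_times_cont_diff_SucI,
        rule has_derivative_add[OF k_times_cont_diff_SucD(1)[OF Suc.prems(1)]
          k_times_cont_diff_SucD(1)[OF Suc.prems(2)]])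
      (intro Suc.IH k_times_cont_diff_SucD(2)[OF Suc.prems(1)]
        k_times_cont_diff_SucD(2)[OF Suc.prems(2)])
qed

text \<open>
  The product rule mixes the factors with their derivatives, so the induction applies its hypothesis
  to \<open>f\<close> and \<open>g\<close> themselves at the lower order.
\<close>

lemma k_times_cont_diff_mult:
  "k_times_cont_diff k f \<Longrightarrow> k_times_cont_diff k g \<Longrightarrow> k_times_cont_diff k (\<lambda>x. f x * g x)"
proof (induction k arbitrary: f g)
  case 0
  then show ?case by (auto intro: continuous_intros)
next
  case (Suc k)
  show ?case
    by (rule k_times_cont_diff_SucI,
        rule has_derivative_mult[OF k_times_cont_diff_SucD(1)[OF Suc.prems(1)]
          k_times_cont_diff_SucD(1)[OF Suc.prems(2)]])
      (intro k_times_cont_diff_add Suc.IH k_times_cont_diff_SucD(2)[OF Suc.prems(1)]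
        k_times_cont_diff_SucD(2)[OF Suc.prems(2)] k_times_cont_diff_Suc_imp[OF Suc.prems(1)]
        k_times_cont_diff_Suc_imp[OF Suc.prems(2)])
qed

text \<open>
  Smoothness is a local property. This serves for infinite sums of bumps, which near each point
  coincide with a single summand.
\<close>

lemma k_times_cont_diff_local:
  assumes "\<And>x. \<exists>U g. open U \<and> x \<in> U \<and> (\<forall>y\<in>U. f y = g y) \<and> k_times_cont_diff k g"
  shows "k_times_cont_diff k f"
  using assms
proof (induction k arbitrary: f)
  case 0
  have "isCont f x" for x
  proof -
    obtain U g where U: "open U" "x \<in> U" "\<forall>y\<in>U. f y = g y" "continuous_on UNIV g"
      using 0[of x] by auto
    then have "continuous_on U f"
      by (metis continuous_on_cong continuous_on_subset subset_UNIV)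
    then show ?thesis
      using U(2) by (simp add: continuous_on_eq_continuous_at[OF U(1)])
  qed
  then show ?case
    by (simp add: continuous_on_eq_continuous_at)
next
  case (Suc k)
  have der: "(f has_derivative frechet_derivative g (at y)) (at y)"
    if "open U" "y \<in> U" "\<forall>y\<in>U. f y = g y" "k_times_cont_diff (Suc k) g" for U g y
    using has_derivative_transform_within_open
      [OF k_times_cont_diff_SucD(1)[OF that(4)] that(1,2)] that(3) by metis
  show ?case
  proof (rule k_times_cont_diff_SucI)
    fix x
    obtain U g where "open U" "x \<in> U" "\<forall>y\<in>U. f y = g y" "k_times_cont_diff (Suc k) g"
      using Suc.prems[of x] by blast
    from der[OF this] show "(f has_derivative frechet_derivative f (at x)) (at x)"
      using frechet_derivative_at[OF der[OF \<open>open U\<close> \<open>x \<in> U\<close> _ \<open>k_times_cont_diff (Suc k) g\<close>]]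
        \<open>\<forall>y\<in>U. f y = g y\<close> by simp
  next
    fix i :: 'a assume i: "i \<in> Basis"
    show "k_times_cont_diff k (\<lambda>x. frechet_derivative f (at x) i)"
    proof (rule Suc.IH)
      fix x
      obtain U g where U: "open U" "x \<in> U" "\<forall>y\<in>U. f y = g y" "k_times_cont_diff (Suc k) g"
        using Suc.prems[of x] by blast
      have "frechet_derivative f (at y) = frechet_derivative g (at y)" if "y \<in> U" for y
        using frechet_derivative_at[OF der[OF U(1) that U(3,4)]] by simp
      then show "\<exists>U g. open U \<and> x \<in> U \<and> (\<forall>y\<in>U. frechet_derivative f (at y) i = g y) \<and>
          k_times_cont_diff k g"
        using U(1,2) k_times_cont_diff_SucD(2)[OF U(4) i]
        by (intro exI[of _ U] exI[of _ "\<lambda>y. frechet_derivative g (at y) i"]) simp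
    qed
  qed
qed

lemma k_times_cont_diff_sq_dist:
  "k_times_cont_diff k (\<lambda>x. (x - a) \<bullet> (x - a))"
proof -
  have affine: "k_times_cont_diff k (\<lambda>x. 2 * ((x - a) \<bullet> b))" for k and b :: 'a
  proof (cases k)
    case (Suc j)
    show ?thesis unfolding Suc
      by (rule k_times_cont_diff_SucI[where f' = "\<lambda>x h. 2 * (h \<bullet> b)"])
        (auto intro!: derivative_eq_intros k_times_cont_diff_const)
  qed (auto intro!: continuous_intros)
  show ?thesis
  proof (cases k)
    case (Suc j)
    have deriv: "((\<lambda>x. (x - a) \<bullet> (x - a)) has_derivative (\<lambda>h. (x - a) \<bullet> h + h \<bullet> (x - a))) (at x)" for x
      by (auto intro!: derivative_eq_intros)
    have "k_times_cont_diff j (\<lambda>x. (x - a) \<bullet> i + i \<bullet> (x - a))" for i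
      using affine[of j i] by (simp add: inner_commute[of i])
    then show ?thesis unfolding Suc
      by (rule k_times_cont_diff_SucI[OF deriv])
  qed (auto intro!: continuous_intros)
qed

section \<open>A smooth bump\<close>

text \<open>
  The function \<open>flat 0\<close> is the classical smooth function that vanishes exactly on the nonpositive reals.
  The further members of the family, obtained on dividing by powers of \<open>s\<close>, make its derivatives expressible:
  the derivative of each member is a linear combination of two others.
\<close>

definition flat :: "nat \<Rightarrow> real \<Rightarrow> real"
  where "flat m s = (if s > 0 then exp (- 1 / s) / s ^ m else 0)"

lemma flat_at_0: "flat m 0 = 0"
  by (simp add: flat_def)

lemma flat_div: "flat m s / s = flat (Suc m) s"
  by (simp add: flat_def)

lemma tendsto_flat_0: "(flat m \<longlongrightarrow> 0) (at 0)"
proof -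
  have "((\<lambda>s::real. exp (- 1 / s) / s ^ m) \<longlongrightarrow> 0) (at_right 0)"
    by real_asymp
  then have "(flat m \<longlongrightarrow> 0) (at_right 0)"
    by (rule Lim_transform_eventually)
       (auto simp: flat_def eventually_at_filter)
  moreover have "(flat m \<longlongrightarrow> 0) (at_left 0)"
    by (rule Lim_transform_eventually[OF tendsto_const])
       (auto simp: flat_def eventually_at_filter)
  ultimately show ?thesis
    by (simp add: filterlim_split_at)
qed

text \<open>
  At 0 the difference quotient of \<open>flat m\<close> is \<open>flat (m + 1)\<close>, and every member of the family tends to 0 there.
\<close>

lemma DERIV_flat:
  "(flat m has_real_derivative (flat (m + 2) s - real m * flat (m + 1) s)) (at s)"
proof -
  consider "s > 0" | "s < 0" | "s = 0" by linarith
  then show ?thesis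
  proof cases
    case 1
    have "((\<lambda>s. exp (- 1 / s) / s ^ m) has_real_derivative
        (flat (m + 2) s - real m * flat (m + 1) s)) (at s)"
      using 1 apply -
      apply (rule derivative_eq_intros refl | simp)+
      \<comment> \<open>The derivative of \<open>s ^ m\<close> contains \<open>s ^ (m - 1)\<close>, whose truncated exponent needs the case split.\<close>
      apply (cases m)
      apply (auto simp: flat_def field_simps power2_eq_square)
      done
    then show ?thesis
      by (rule has_field_derivative_transform_within_open[where S = "{0<..}"])
        (use 1 in \<open>auto simp: flat_def\<close>)
  next
    case 2
    have "((\<lambda>s. 0) has_real_derivative (flat (m + 2) s - real m * flat (m + 1) s)) (at s)"
      using 2 by (auto simp: flat_def)
    then show ?thesis
      by (rule has_field_derivative_transform_within_open[where S = "{..<0}"])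
        (use 2 in \<open>auto simp: flat_def\<close>)
  next
    case 3
    have "((\<lambda>h. (flat m (0 + h) - flat m 0) / h) \<longlongrightarrow> 0) (at 0)"
      using tendsto_flat_0[of "Suc m"] by (simp add: flat_at_0 flat_div)
    then show ?thesis
      by (simp add: 3 DERIV_def flat_def)
  qed
qed

text \<open>
  The chain rule stays inside the family \<open>flat\<close>, so one induction on the order settles all \<open>m\<close> together.
\<close>

lemma k_times_cont_diff_flat:
  "k_times_cont_diff k q \<Longrightarrow> k_times_cont_diff k (\<lambda>x. flat m (q x))"
proof (induction k arbitrary: m)
  case 0
  have "continuous_on UNIV (flat m)"
    using DERIV_flat DERIV_isCont by (fastforce simp: continuous_on_eq_continuous_at)
  then show ?case
    using 0 by (auto intro: continuous_on_compose2)
next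
  case (Suc k)
  let ?D = "\<lambda>x. flat (m + 2) (q x) + (- real m) * flat (m + 1) (q x)"
  show ?case
  proof (rule k_times_cont_diff_SucI)
    fix x
    show "((\<lambda>x. flat m (q x)) has_derivative
        (\<lambda>h. ?D x * frechet_derivative q (at x) h)) (at x)"
      using has_derivative_compose[OF k_times_cont_diff_SucD(1)[OF Suc.prems, of x]
          DERIV_flat[unfolded has_field_derivative_def]]
      by simp
  next
    fix i :: 'a assume "i \<in> Basis"
    then show "k_times_cont_diff k (\<lambda>x. ?D x * frechet_derivative q (at x) i)"
      by (intro k_times_cont_diff_mult k_times_cont_diff_add k_times_cont_diff_const
          Suc.IH k_times_cont_diff_SucD(2)[OF Suc.prems]
          k_times_cont_diff_Suc_imp[OF Suc.prems])
  qed
qed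

text \<open>
  The factor \<open>exp 1\<close> normalises the value at the centre to 1. The squared norm is written as an inner product
  because this expression, unlike the norm, is visibly smooth.
\<close>

definition bump :: "'a::euclidean_space \<Rightarrow> real \<Rightarrow> 'a \<Rightarrow> real"
  where "bump a r x = exp 1 * flat 0 (1 - (x - a) \<bullet> (x - a) / r\<^sup>2)"

lemma smooth_bump: "smooth (bump a r)"
proof -
  have "k_times_cont_diff k (\<lambda>x. exp 1 * flat 0 (1 + (- 1 / r\<^sup>2) * ((x - a) \<bullet> (x - a))))" for k
    by (intro k_times_cont_diff_mult k_times_cont_diff_add k_times_cont_diff_const
        k_times_cont_diff_flat k_times_cont_diff_sq_dist)
  then show ?thesis
    by (simp add: smooth_def bump_def[abs_def])
qed

lemma bump_center [simp]: "bump a r a = 1"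
  by (simp add: bump_def flat_def exp_minus)

lemma bump_nonneg: "0 \<le> bump a r x"
  by (simp add: bump_def flat_def)

lemma bump_le_1: "bump a r x \<le> 1"
proof (cases "1 - (x - a) \<bullet> (x - a) / r\<^sup>2 > 0")
  case True
  define s where "s = 1 - (x - a) \<bullet> (x - a) / r\<^sup>2"
  have "0 < s" "s \<le> 1" using True by (auto simp: s_def)
  then have "exp 1 * exp (- 1 / s) \<le> 1"
    by (simp flip: exp_add)
  then show ?thesis
    using True by (simp add: bump_def flat_def s_def)
qed (simp add: bump_def flat_def)

lemma bump_eq_0: "r > 0 \<Longrightarrow> x \<notin> ball a r \<Longrightarrow> bump a r x = 0"
proof -
  assume r: "r > 0" and "x \<notin> ball a r"
  then have "r\<^sup>2 \<le> (norm (x - a))\<^sup>2"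
    by (intro power_mono) (auto simp: dist_norm norm_minus_commute)
  then show ?thesis
    using r by (simp add: bump_def flat_def field_simps power2_norm_eq_inner)
qed

section \<open>The ambient vector space\<close>

lemma smooth_add: "smooth f \<Longrightarrow> smooth g \<Longrightarrow> smooth (f + g)"
  by (simp add: smooth_def plus_fun_def k_times_cont_diff_add)

lemma smooth_scaleR: "smooth f \<Longrightarrow> smooth (c *\<^sub>R f)"
  by (simp add: smooth_def scaleR_fun_def k_times_cont_diff_mult k_times_cont_diff_const)

lemma smooth_imp_continuous: "smooth f \<Longrightarrow> continuous_on UNIV f"
  using k_times_cont_diff.simps(1) unfolding smooth_def by blast

lemma p_integrable_0: "p_integrable p (0 :: 'a::euclidean_space \<Rightarrow> real)"
  by (simp add: p_integrable_def zero_fun_def)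

lemma p_integrable_scaleR: "p_integrable p f \<Longrightarrow> p_integrable p (c *\<^sub>R f)"
  by (auto simp: p_integrable_def scaleR_fun_def abs_mult powr_mult)

lemma p_integrable_add:
  assumes "p_integrable p f" "p_integrable p g" "p \<ge> 0"
  shows "p_integrable p (f + g)"
proof -
  have [measurable]: "f \<in> borel_measurable lebesgue" "g \<in> borel_measurable lebesgue"
    using assms by (auto simp: p_integrable_def)
  have bound: "\<bar>f x + g x\<bar> powr p \<le> 2 powr p * (\<bar>f x\<bar> powr p + \<bar>g x\<bar> powr p)" for x
  proof -
    have "\<bar>f x + g x\<bar> powr p \<le> (2 * max \<bar>f x\<bar> \<bar>g x\<bar>) powr p"
      using assms(3) by (intro powr_mono2) auto
    also have "\<dots> = 2 powr p * max \<bar>f x\<bar> \<bar>g x\<bar> powr p"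
      by (simp add: powr_mult)
    also have "\<dots> \<le> 2 powr p * (\<bar>f x\<bar> powr p + \<bar>g x\<bar> powr p)"
      by (intro mult_left_mono) (auto simp: max_def)
    finally show ?thesis .
  qed
  have "integrable lebesgue (\<lambda>x. 2 powr p * (\<bar>f x\<bar> powr p + \<bar>g x\<bar> powr p))"
    using assms by (auto simp: p_integrable_def)
  then have "integrable lebesgue (\<lambda>x. \<bar>f x + g x\<bar> powr p)"
    by (rule Bochner_Integration.integrable_bound) (use bound in \<open>auto intro!: AE_I2\<close>)
  then show ?thesis
    by (simp add: p_integrable_def plus_fun_def)
qed

lemma subspace_CinfI: "subspace (CinfI :: ('a::euclidean_space \<Rightarrow> real) set)"
  unfolding subspace_def CinfI_def
  by (auto intro: smooth_add smooth_scaleR p_integrable_add p_integrable_scaleR p_integrable_0)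
    (simp add: smooth_def zero_fun_def k_times_cont_diff_const)


section \<open>Locally finite series of bumps\<close>

lemma summable_powr_geometric:
  fixes p :: real
  shows "summable (\<lambda>n. (real n + 1) powr p * (1 / 2) ^ n)"
proof (rule summable_comparison_test_bigo)
  show "summable (\<lambda>n. norm ((2 / 3 :: real) ^ n))"
    by (simp add: summable_geometric)
  show "(\<lambda>n. (real n + 1) powr p * (1 / 2) ^ n) \<in> O(\<lambda>n. (2 / 3) ^ n)"
    by real_asymp
qed

text \<open>
  Points at mutual distance at least 2 keep the bumps of radius at most \<open>1 / 2\<close> so far apart that
  any ball of radius \<open>1 / 2\<close> meets the support of at most one of them.
\<close>

locale separated_points =
  fixes a :: "nat \<Rightarrow> 'a::euclidean_space"
  assumes separated: "m \<noteq> n \<Longrightarrow> 2 \<le> dist (a m) (a n)"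
begin

abbreviation radius :: "nat \<Rightarrow> real"
  where "radius n \<equiv> (1 / 2) ^ Suc n"

abbreviation spike :: "nat \<Rightarrow> 'a \<Rightarrow> real"
  where "spike n \<equiv> bump (a n) (radius n)"

definition bump_series :: "(nat \<Rightarrow> real) \<Rightarrow> 'a \<Rightarrow> real"
  where "bump_series c = (\<lambda>x. \<Sum>n. c n * spike n x)"

lemma spike_eq_0:
  assumes "x \<notin> ball (a n) (radius n)"
  shows "spike n x = 0"
  by (rule bump_eq_0) (use assms in auto)

text \<open>
  If bumps with different indices were nonzero at points of the same ball, both of their centres would have distance
  less than 1 from its centre, and so distance less than 2 from each other.
\<close>

lemma at_most_one_spike: "\<exists>n. \<forall>y\<in>ball x (1 / 2). \<forall>m. m \<noteq> n \<longrightarrow> spike m y = 0"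
proof (cases "\<exists>n. \<exists>y\<in>ball x (1 / 2). spike n y \<noteq> 0")
  case True
  have near: "dist (a n) x < 1" if y: "y \<in> ball x (1 / 2)" "spike n y \<noteq> 0" for n y
  proof -
    have "y \<in> ball (a n) (radius n)"
      using spike_eq_0 y(2) by blast
    moreover have "radius n \<le> 1 / 2"
      by (simp add: power_le_one)
    ultimately have "dist (a n) y < 1 / 2"
      by simp
    with y(1) show ?thesis
      using dist_triangle[of "a n" x y] by (simp add: dist_commute)
  qed
  from True obtain n y where n: "y \<in> ball x (1 / 2)" "spike n y \<noteq> 0"
    by blast
  have "spike m z = 0" if "z \<in> ball x (1 / 2)" "m \<noteq> n" for m z
  proof (rule ccontr)
    assume "spike m z \<noteq> 0"
    from near[OF that(1) this] near[OF n] show False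
      using separated[OF that(2)] dist_triangle2[of "a m" "a n" x] by simp
  qed
  then show ?thesis
    by blast
qed blast

lemma bump_series_single:
  assumes "\<forall>m. m \<noteq> n \<longrightarrow> spike m x = 0"
  shows "bump_series c x = c n * spike n x"
  unfolding bump_series_def using assms by (subst suminf_finite[of "{n}"]) auto

lemma bump_series_at_point [simp]: "bump_series c (a n) = c n"
proof -
  have "spike m (a n) = 0" if "m \<noteq> n" for m
  proof (rule spike_eq_0)
    have "radius m \<le> 1"
      by (intro power_le_one) auto
    then show "a n \<notin> ball (a m) (radius m)"
      using separated[OF that] by (auto simp del: power_Suc)
  qed
  then show ?thesis
    by (subst bump_series_single[of n]) auto
qed

text \<open>
  At each point all series involved reduce to their term of one and the same index, where linearity is evident.
\<close>

lemma linear_bump_series: "linear bump_series"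
proof (rule linearI; rule ext)
  fix c d :: "nat \<Rightarrow> real" and s :: real and x :: 'a
  obtain n where "\<forall>m. m \<noteq> n \<longrightarrow> spike m x = 0"
    using at_most_one_spike[of x] by (metis centre_in_ball divide_pos_pos zero_less_numeral zero_less_one)
  note single = bump_series_single[OF this]
  show "bump_series (c + d) x = (bump_series c + bump_series d) x"
    by (simp add: single algebra_simps)
  show "bump_series (s *\<^sub>R c) x = (s *\<^sub>R bump_series c) x"
    by (simp add: single)
qed

lemma inj_bump_series: "inj bump_series"
proof (rule injI, rule ext)
  fix c d n
  assume "bump_series c = bump_series d"
  then show "c n = d n"
    by (metis bump_series_at_point)
qed

lemma smooth_bump_series: "smooth (bump_series c)"
  unfolding smooth_def
proof (intro allI k_times_cont_diff_local)
  fix k and x :: 'a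
  obtain n where "\<forall>y\<in>ball x (1 / 2). \<forall>m. m \<noteq> n \<longrightarrow> spike m y = 0"
    using at_most_one_spike by blast
  then have "\<forall>y\<in>ball x (1 / 2). bump_series c y = c n * spike n y"
    using bump_series_single by blast
  moreover have "k_times_cont_diff k (\<lambda>y. c n * spike n y)"
    using smooth_bump unfolding smooth_def
    by (intro k_times_cont_diff_mult k_times_cont_diff_const) blast
  moreover have "x \<in> ball x (1 / 2)"
    by simp
  ultimately show "\<exists>U g. open U \<and> x \<in> U \<and> (\<forall>y\<in>U. bump_series c y = g y) \<and> k_times_cont_diff k g"
    by (intro exI[of _ "ball x (1 / 2)"] exI[of _ "\<lambda>y. c n * spike n y"]) simp
qed

text \<open>
  A positive power of a bump is at most the indicator function of the supporting ball. As the radius is at most 1,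
  the volume of this ball is at most a constant times the radius, whatever the dimension.
\<close>

lemma integral_spike_powr:
  assumes "p > 0"
  shows "integrable lebesgue (\<lambda>x. spike n x powr p)"
    and "(\<integral>x. spike n x powr p \<partial>lebesgue) \<le> unit_ball_vol (DIM('a)) * (1 / 2) ^ n"
proof -
  let ?B = "ball (a n) (radius n)"
  have "continuous_on UNIV (spike n)"
    by (rule smooth_imp_continuous[OF smooth_bump])
  then have [measurable]: "spike n \<in> borel_measurable lebesgue"
    by (simp add: borel_measurable_continuous_onI measurable_completion)
  have le: "spike n x powr p \<le> indicator ?B x" for x
  proof (cases "x \<in> ?B")
    case True
    then show ?thesis
      using powr_le1[of p "spike n x"] bump_nonneg[of "a n" "radius n" x] bump_le_1[of "a n" "radius n" x] assms
      by (simp add: abs_of_nonneg)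
  next
    case False
    show ?thesis
      unfolding spike_eq_0[OF False] by simp
  qed
  have B: "integrable lebesgue (indicator ?B :: 'a \<Rightarrow> real)"
    by (simp add: lmeasurable_ball flip: lmeasurable_iff_integrable)
  show int: "integrable lebesgue (\<lambda>x. spike n x powr p)"
  proof (rule Bochner_Integration.integrable_bound[OF B])
    show "(\<lambda>x. spike n x powr p) \<in> borel_measurable lebesgue"
      by measurable
  qed (use le in \<open>auto intro!: always_eventually\<close>)
  have "(\<integral>x. spike n x powr p \<partial>lebesgue) \<le> (\<integral>x. indicator ?B x \<partial>lebesgue)"
    by (rule integral_mono[OF int B le])
  also have "\<dots> = measure lebesgue ?B"
    by (simp add: measure_def)
  also have "\<dots> = unit_ball_vol (DIM('a)) * radius n ^ DIM('a)"
    by (simp add: content_ball)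
  also have "\<dots> \<le> unit_ball_vol (DIM('a)) * (1 / 2) ^ n"
  proof (intro mult_left_mono)
    have "radius n ^ DIM('a) \<le> radius n ^ 1"
      by (rule power_decreasing) (auto simp: power_le_one Suc_le_eq simp del: power_Suc)
    also have "\<dots> \<le> (1 / 2) ^ n"
      by simp
    finally show "radius n ^ DIM('a) \<le> (1 / 2) ^ n" .
  qed auto
  finally show "(\<integral>x. spike n x powr p \<partial>lebesgue) \<le> unit_ball_vol (DIM('a)) * (1 / 2) ^ n" .
qed

text \<open>
  The bumps have disjoint supports, so the \<open>p\<close>-th power may be taken term by term. The integrals of the terms
  are then a power of \<open>n + 1\<close> times a geometric sequence.
\<close>

lemma p_integrable_bump_series:
  assumes "p > 0" and growth: "\<And>n. \<bar>c n\<bar> \<le> K * (real n + 1)"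
  shows "p_integrable p (bump_series c)"
proof -
  define g where "g n x = \<bar>c n\<bar> powr p * spike n x powr p" for n x
  have eq: "(\<lambda>n. g n x) sums \<bar>bump_series c x\<bar> powr p" for x
  proof -
    obtain n where n: "\<forall>m. m \<noteq> n \<longrightarrow> spike m x = 0"
      using at_most_one_spike[of x] by (metis centre_in_ball divide_pos_pos zero_less_numeral zero_less_one)
    have "(\<lambda>m. g m x) sums (\<Sum>m\<in>{n}. g m x)"
      using n assms(1) by (intro sums_finite) (auto simp: g_def)
    also have "(\<Sum>m\<in>{n}. g m x) = \<bar>bump_series c x\<bar> powr p"
      by (simp add: bump_series_single[OF n] g_def abs_mult powr_mult bump_nonneg)
    finally show ?thesis .
  qed
  have g_nonneg: "0 \<le> g n x" for n x
    by (simp add: g_def)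
  have K: "0 \<le> K"
    using growth[of 0] by simp
  have int: "integrable lebesgue (g n)" for n
    using integral_spike_powr(1)[OF assms(1)] by (simp add: g_def[abs_def])
  have "summable (\<lambda>n. \<integral>x. norm (g n x) \<partial>lebesgue)"
  proof (rule summable_comparison_test')
    show "summable (\<lambda>n. K powr p * unit_ball_vol (DIM('a)) * ((real n + 1) powr p * (1 / 2) ^ n))"
      by (intro summable_mult summable_powr_geometric)
    fix n
    have "(\<integral>x. norm (g n x) \<partial>lebesgue) = \<bar>c n\<bar> powr p * (\<integral>x. spike n x powr p \<partial>lebesgue)"
      by (simp add: g_def abs_mult)
    also have "\<dots> \<le> (K * (real n + 1)) powr p * (unit_ball_vol (DIM('a)) * (1 / 2) ^ n)"
      using integral_spike_powr(2)[OF assms(1)] growth[of n] assms(1)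
      by (intro mult_mono powr_mono2) auto
    also have "\<dots> = K powr p * unit_ball_vol (DIM('a)) * ((real n + 1) powr p * (1 / 2) ^ n)"
      using K by (simp add: powr_mult)
    finally show "norm (\<integral>x. norm (g n x) \<partial>lebesgue)
        \<le> K powr p * unit_ball_vol (DIM('a)) * ((real n + 1) powr p * (1 / 2) ^ n)"
      by simp
  qed
  moreover have "AE x in lebesgue. summable (\<lambda>n. norm (g n x))"
    using eq sums_summable g_nonneg by (intro always_eventually) (auto simp: summable_def)
  ultimately have "integrable lebesgue (\<lambda>x. \<Sum>n. g n x)"
    using int by (intro integrable_suminf)
  then have "integrable lebesgue (\<lambda>x. \<bar>bump_series c x\<bar> powr p)"
    using eq by (simp add: sums_iff)
  moreover have "bump_series c \<in> borel_measurable lebesgue"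
    using smooth_imp_continuous[OF smooth_bump_series]
    by (simp add: borel_measurable_continuous_onI measurable_completion)
  ultimately show ?thesis
    by (simp add: p_integrable_def)
qed

lemma bump_series_in_CinfI:
  assumes "\<And>n. \<bar>c n\<bar> \<le> K * (real n + 1)"
  shows "bump_series c \<in> CinfI"
  using smooth_bump_series p_integrable_bump_series[OF _ assms] by (auto simp: CinfI_def)

end

section \<open>Spaces of unbounded sequences\<close>

text \<open>
  Position \<open>j\<close> of row \<open>i\<close> is the index \<open>prod_encode (i, j)\<close>. Exponents between 0 and 1 provide
  continuum many sequences, all of at most linear growth.
\<close>

definition power_seq :: "nat \<Rightarrow> real \<Rightarrow> nat \<Rightarrow> real"
  where "power_seq k t n = (case prod_decode n of (i, j) \<Rightarrow> if i = k then (real j + 1) powr t else 0)"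

lemma power_seq_encode [simp]:
  "power_seq k t (prod_encode (i, j)) = (if i = k then (real j + 1) powr t else 0)"
  by (simp add: power_seq_def)

lemma inj_power_seq: "inj (power_seq k)"
proof (rule injI)
  fix s t
  assume "power_seq k s = power_seq k t"
  then have "power_seq k s (prod_encode (k, 1)) = power_seq k t (prod_encode (k, 1))"
    by simp
  then show "s = t"
    by (simp add: powr_inj)
qed

lemma power_seq_le:
  assumes "0 \<le> t" "t \<le> 1"
  shows "\<bar>power_seq k t n\<bar> \<le> real n + 1"
proof -
  obtain i j where n: "n = prod_encode (i, j)"
    by (metis prod.exhaust prod_decode_inverse)
  have "(real j + 1) powr t \<le> (real j + 1) powr 1"
    using assms by (intro powr_mono) auto
  also have "\<dots> \<le> real n + 1"
    using le_prod_encode_2[of j i] by (simp add: n)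
  finally show ?thesis
    by (auto simp: n)
qed

text \<open>
  Divide by the power with the largest exponent \<open>m\<close>. The quotient tends to the coefficient of that power,
  which is not 0; but if the sum were bounded, the quotient would tend to 0, since \<open>m > 0\<close>.
\<close>

lemma unbounded_sum_powr:
  fixes \<beta> :: "real \<Rightarrow> real"
  assumes "finite T" "T \<noteq> {}" "\<And>t. t \<in> T \<Longrightarrow> 0 < t" "\<And>t. t \<in> T \<Longrightarrow> \<beta> t \<noteq> 0"
  shows "\<not> bounded (range (\<lambda>j. \<Sum>t\<in>T. \<beta> t * (real j + 1) powr t))"
proof
  define m where "m = Max T"
  have m: "m \<in> T" "\<And>t. t \<in> T \<Longrightarrow> t \<le> m"
    using assms by (auto simp: m_def)
  assume "bounded (range (\<lambda>j. \<Sum>t\<in>T. \<beta> t * (real j + 1) powr t))"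
  then obtain B where B: "\<And>j. \<bar>\<Sum>t\<in>T. \<beta> t * (real j + 1) powr t\<bar> \<le> B"
    by (auto simp: bounded_iff)
  have "(\<lambda>j. \<Sum>t\<in>T. \<beta> t * (real j + 1) powr (t - m)) \<longlonglongrightarrow> (\<Sum>t\<in>T. if t = m then \<beta> m else 0)"
  proof (rule tendsto_sum)
    fix t assume "t \<in> T"
    show "(\<lambda>j. \<beta> t * (real j + 1) powr (t - m)) \<longlonglongrightarrow> (if t = m then \<beta> m else 0)"
    proof (cases "t = m")
      case False
      then have "t - m < 0"
        using m(2)[OF \<open>t \<in> T\<close>] by simp
      then have "(\<lambda>j. (real j + 1) powr (t - m)) \<longlonglongrightarrow> 0"
        by real_asymp
      then show ?thesis
        using False tendsto_mult_right_zero by auto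
    qed simp
  qed
  then have "(\<lambda>j. \<Sum>t\<in>T. \<beta> t * (real j + 1) powr (t - m)) \<longlonglongrightarrow> \<beta> m"
    using assms(1) m(1) by simp
  moreover have "(\<lambda>j. \<Sum>t\<in>T. \<beta> t * (real j + 1) powr (t - m)) \<longlonglongrightarrow> 0"
  proof (rule Lim_null_comparison)
    have "m > 0"
      using m(1) assms(3) by simp
    then show "(\<lambda>j. B * (real j + 1) powr (- m)) \<longlonglongrightarrow> 0"
      by real_asymp
    have "(\<Sum>t\<in>T. \<beta> t * (real j + 1) powr (t - m))
        = (\<Sum>t\<in>T. \<beta> t * (real j + 1) powr t) * (real j + 1) powr (- m)" for j
      by (simp add: sum_distrib_right powr_add[symmetric] mult.assoc)
    then show "\<forall>\<^sub>F j in sequentially. norm (\<Sum>t\<in>T. \<beta> t * (real j + 1) powr (t - m))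
        \<le> B * (real j + 1) powr (- m)"
      using B by (auto simp: abs_mult intro!: always_eventually mult_right_mono)
  qed
  ultimately have "\<beta> m = 0"
    by (rule LIMSEQ_unique)
  with assms(4) m(1) show False
    by blast
qed

lemma sum_scaleR_apply: "(\<Sum>v\<in>S. u v *\<^sub>R v) n = (\<Sum>v\<in>S. u v * v n)"
  for u :: "(nat \<Rightarrow> real) \<Rightarrow> real"
  by (induction S rule: infinite_finite_induct) auto

text \<open>
  This is the form of the preceding lemma that matches the description of spans and of linear
  independence by finite sums. Terms with coefficient 0 are discarded first, as the largest
  exponent must come from a nonzero term.
\<close>

lemma unbounded_power_seq_combination:
  assumes "finite S" "S \<subseteq> power_seq k ` {0<..<1}" "v \<in> S" "u v \<noteq> 0"
  shows "\<not> bounded (range (\<lambda>j. (\<Sum>v\<in>S. u v *\<^sub>R v) (prod_encode (k, j))))"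
proof -
  obtain T where T: "T \<subseteq> {0<..<1}" "finite T" "S = power_seq k ` T"
    using finite_subset_image[OF assms(1,2)] by blast
  define T' where "T' = {t \<in> T. u (power_seq k t) \<noteq> 0}"
  have "(\<Sum>v\<in>S. u v *\<^sub>R v) (prod_encode (k, j)) =
      (\<Sum>t\<in>T'. u (power_seq k t) * (real j + 1) powr t)" for j
  proof -
    have "(\<Sum>v\<in>S. u v *\<^sub>R v) (prod_encode (k, j)) =
        (\<Sum>t\<in>T. u (power_seq k t) * (real j + 1) powr t)"
      unfolding sum_scaleR_apply T(3)
      by (subst sum.reindex) (auto intro: inj_on_subset[OF inj_power_seq])
    also have "\<dots> = (\<Sum>t\<in>T'. u (power_seq k t) * (real j + 1) powr t)"
      using T(2) by (intro sum.mono_neutral_right) (auto simp: T'_def)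
    finally show ?thesis .
  qed
  moreover have "\<not> bounded (range (\<lambda>j. \<Sum>t\<in>T'. u (power_seq k t) * (real j + 1) powr t))"
    by (rule unbounded_sum_powr) (use T assms(3,4) in \<open>auto simp: T'_def\<close>)
  ultimately show ?thesis
    by simp
qed

lemma independent_power_seq: "independent (power_seq k ` {0<..<1})"
  unfolding independent_explicit_finite_subsets
proof (intro allI impI ballI, rule ccontr)
  fix S u v
  assume "S \<subseteq> power_seq k ` {0<..<1}" "finite S" "(\<Sum>v\<in>S. u v *\<^sub>R v) = 0" "v \<in> S" "u v \<noteq> 0"
  then show False
    using unbounded_power_seq_combination[of S k v u] by (simp add: image_constant_conv)
qed

definition row_space :: "nat \<Rightarrow> (nat \<Rightarrow> real) set"
  where "row_space k = span (power_seq k ` {0<..<1})"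

lemma row_space_unbounded:
  assumes "c \<in> row_space k" "c \<noteq> 0"
  shows "\<not> bounded (range (\<lambda>j. c (prod_encode (k, j))))"
proof -
  obtain S u where S: "finite S" "S \<subseteq> power_seq k ` {0<..<1}" "c = (\<Sum>v\<in>S. u v *\<^sub>R v)"
    using assms(1) unfolding row_space_def span_explicit by blast
  have "\<exists>v\<in>S. u v \<noteq> 0"
  proof (rule ccontr)
    assume "\<not> ?thesis"
    then have "c = 0"
      unfolding S(3) by (intro sum.neutral) simp
    with assms(2) show False ..
  qed
  then obtain v where "v \<in> S" "u v \<noteq> 0"
    by blast
  then show ?thesis
    using unbounded_power_seq_combination[OF S(1,2)] S(3) by blast
qed

lemma row_space_off_row:
  assumes "c \<in> row_space k" "i \<noteq> k"
  shows "c (prod_encode (i, j)) = 0"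
proof -
  have "subspace {c :: nat \<Rightarrow> real. c (prod_encode (i, j)) = 0}"
    by (simp add: subspace_def)
  then have "row_space k \<subseteq> {c. c (prod_encode (i, j)) = 0}"
    unfolding row_space_def using assms(2) by (intro span_minimal) auto
  with assms(1) show ?thesis
    by blast
qed

lemma row_space_growth:
  assumes "c \<in> row_space k"
  shows "\<exists>K. \<forall>n. \<bar>c n\<bar> \<le> K * (real n + 1)"
  using assms unfolding row_space_def
proof (induction rule: span_induct_alt)
  case base
  then show ?case
    by (intro exI[of _ 0]) simp
next
  case (step s v c)
  then obtain K where K: "\<And>n. \<bar>c n\<bar> \<le> K * (real n + 1)"
    by blast
  have v: "\<bar>v n\<bar> \<le> real n + 1" for n
    using step.hyps(1) power_seq_le by force
  have "\<bar>(s *\<^sub>R v + c) n\<bar> \<le> (\<bar>s\<bar> + K) * (real n + 1)" for n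
  proof -
    have "\<bar>(s *\<^sub>R v + c) n\<bar> \<le> \<bar>s\<bar> * \<bar>v n\<bar> + \<bar>c n\<bar>"
      by (simp add: abs_triangle_ineq flip: abs_mult)
    also have "\<dots> \<le> \<bar>s\<bar> * (real n + 1) + K * (real n + 1)"
      using v K by (intro add_mono mult_left_mono) auto
    finally show ?thesis
      by (simp add: distrib_right)
  qed
  then show ?case
    by blast
qed

lemma row_space_Int:
  assumes "c \<in> row_space k" "c \<in> row_space l" "k \<noteq> l"
  shows "c = 0"
  using row_space_unbounded[OF assms(1)] row_space_off_row[OF assms(2,3)]
  by (auto simp: image_constant_conv)

section \<open>Subspaces of unbounded functions\<close>

text \<open>
  Values of \<open>f\<close> on a ball are bounded by compactness, so arbitrarily large values on \<open>A\<close> occur arbitrarily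
  far from the origin. Choosing each point with norm at least 2 more than the previous one gives the separation.
\<close>

lemma separated_sequence_of_large_values:
  fixes f :: "'a::euclidean_space \<Rightarrow> real"
  assumes "continuous_on UNIV f" and unbdd: "\<not> bounded (f ` A)"
  obtains a where "separated_points a" "\<And>n. a n \<in> A" "\<And>n. real n + 1 \<le> \<bar>f (a n)\<bar>"
proof -
  have far: "\<exists>x\<in>A. K \<le> \<bar>f x\<bar> \<and> R \<le> norm x" for K R
  proof (rule ccontr)
    assume neg: "\<not> ?thesis"
    have "bounded (f ` cball 0 R)"
      using assms(1) by (meson compact_cball compact_continuous_image compact_imp_bounded
          continuous_on_subset subset_UNIV)
    moreover have "bounded {- K..K}"
      by simp
    moreover have "f ` A \<subseteq> f ` cball 0 R \<union> {- K..K}"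
    proof (intro image_subsetI)
      fix x
      assume "x \<in> A"
      with neg have "\<bar>f x\<bar> < K \<or> norm x < R"
        by force
      then show "f x \<in> f ` cball 0 R \<union> {- K..K}"
        by (auto simp: abs_if split: if_splits)
    qed
    ultimately show False
      using unbdd bounded_subset bounded_Un by metis
  qed
  have "\<exists>a. \<forall>n. (a n \<in> A \<and> real n + 1 \<le> \<bar>f (a n)\<bar>) \<and> norm (a n) + 2 \<le> norm (a (Suc n))"
    by (rule dependent_nat_choice) (use far in blast)+
  then obtain a where a: "\<And>n. a n \<in> A" "\<And>n. real n + 1 \<le> \<bar>f (a n)\<bar>"
    "\<And>n. norm (a n) + 2 \<le> norm (a (Suc n))"
    by blast
  have less: "norm (a m) + 2 \<le> norm (a n)" if "m < n" for m n
    using that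
  proof (induction n)
    case (Suc n)
    then show ?case
      using a(3)[of n] by (cases "m = n") (auto simp: less_Suc_eq)
  qed simp
  have "2 \<le> dist (a m) (a n)" if "m \<noteq> n" for m n
    using that less[of m n] less[of n m] norm_triangle_ineq3[of "a m" "a n"]
    by (cases m n rule: linorder_cases) (auto simp: dist_norm)
  then have "separated_points a"
    by unfold_locales
  from that[OF this a(1,2)] show ?thesis .
qed

text \<open>
  For the intersection of \<open>W k\<close> and \<open>W l\<close> the row \<open>k + l + 1\<close> is used, which differs from both
  \<open>k\<close> and \<open>l\<close>; for the unboundedness of functions with \<open>s \<noteq> 0\<close> the row after \<open>k\<close>.
\<close>

theorem infinitely_pointwise_lineable_nBCinfI:
  fixes A :: "'a::euclidean_space set"
  shows "infinitely_pointwise_lineable |UNIV :: real set| CinfI (nBCinfI A)"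
  unfolding infinitely_pointwise_lineable_def
proof (intro conjI ballI)
  show "cinfinite |UNIV :: real set|"
    using infinite_UNIV_char_0[where 'a = real] by (simp add: cinfinite_def Field_card_of)
  show "Card_order |UNIV :: real set|"
    by (rule card_of_Card_order)
  show "subspace (CinfI :: ('a \<Rightarrow> real) set)"
    by (rule subspace_CinfI)
  show "nBCinfI A \<subseteq> CinfI"
    by (auto simp: nBCinfI_def)
  fix f
  assume "f \<in> nBCinfI A"
  then have f: "f \<in> CinfI" "\<not> bounded (f ` A)"
    by (auto simp: nBCinfI_def)
  then have "continuous_on UNIV f"
    by (auto simp: CinfI_def intro: smooth_imp_continuous)
  then obtain a where "separated_points a"
    and a: "\<And>n. a n \<in> A" "\<And>n. real n + 1 \<le> \<bar>f (a n)\<bar>"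
    using separated_sequence_of_large_values f(2) by metis
  interpret separated_points a by fact
  let ?G = "\<lambda>k. bump_series ` power_seq k ` {0<..<1}"
  define W where "W k = span (insert f (?G k))" for k
  have W_iff: "w \<in> W k \<longleftrightarrow> (\<exists>s. \<exists>c\<in>row_space k. w = s *\<^sub>R f + bump_series c)" for w k
  proof -
    have "span (?G k) = bump_series ` row_space k"
      unfolding row_space_def by (rule linear_span_image[OF linear_bump_series])
    then show ?thesis
      unfolding W_def span_breakdown_eq by (auto simp: image_iff algebra_simps)
  qed
  have bump_CinfI: "bump_series c \<in> CinfI" if "c \<in> row_space k" for c k
    using row_space_growth[OF that] bump_series_in_CinfI by blast
  have f_nonzero: "f (a n) \<noteq> 0" for n
    using a(2)[of n] by auto
  have f_unbounded: "s = 0"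
    if "bounded ((s *\<^sub>R f + bump_series c) ` A)" "c \<in> row_space k" for s c k
  proof (rule ccontr)
    assume "s \<noteq> 0"
    obtain B where B: "\<And>x. x \<in> A \<Longrightarrow> \<bar>s * f x + bump_series c x\<bar> \<le> B"
      using \<open>bounded _\<close> by (auto simp: bounded_iff)
    obtain j where j: "B / \<bar>s\<bar> < real j"
      using reals_Archimedean2 by blast
    \<comment> \<open>At points of a row other than \<open>k\<close> only the multiple of \<open>f\<close> remains.\<close>
    let ?n = "prod_encode (Suc k, j)"
    have "c ?n = 0"
      using row_space_off_row[OF \<open>c \<in> row_space k\<close>] by simp
    then have "\<bar>s\<bar> * \<bar>f (a ?n)\<bar> \<le> B"
      using B[OF a(1), of ?n] by (simp add: abs_mult)
    then have "\<bar>f (a ?n)\<bar> \<le> B / \<bar>s\<bar>"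
      using \<open>s \<noteq> 0\<close> by (simp add: field_simps)
    then show False
      using a(2)[of ?n] j le_prod_encode_2[of j "Suc k"] by linarith
  qed
  have bump_unbounded: "c = 0"
    if "bounded (bump_series c ` A)" "c \<in> row_space k" for c k
  proof -
    have "range (\<lambda>j. c (prod_encode (k, j))) \<subseteq> bump_series c ` A"
    proof (intro image_subsetI)
      fix j
      have "bump_series c (a (prod_encode (k, j))) \<in> bump_series c ` A"
        using a(1) by (rule imageI)
      then show "c (prod_encode (k, j)) \<in> bump_series c ` A"
        by simp
    qed
    then show ?thesis
      using row_space_unbounded[OF that(2)] bounded_subset[OF that(1)] by blast
  qed
  have dimension: "has_dimension (W k) |UNIV :: real set|" for k
    unfolding has_dimension_def
  proof (intro exI[of _ "insert f (?G k)"] conjI)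
    have "f \<notin> span (?G k)"
    proof
      assume "f \<in> span (?G k)"
      then obtain c where c: "c \<in> row_space k" "f = bump_series c"
        unfolding row_space_def linear_span_image[OF linear_bump_series] by blast
      then have "f (a (prod_encode (Suc k, 0))) = 0"
        using row_space_off_row by simp
      then show False
        using f_nonzero by blast
    qed
    moreover have "independent (?G k)"
      using linear_independent_injective_image[OF linear_bump_series independent_power_seq]
        inj_bump_series by (simp add: inj_on_subset)
    ultimately show "independent (insert f (?G k))"
      by (rule independent_insertI)
    show "span (insert f (?G k)) = W k"
      by (simp add: W_def)
    have "?G k \<approx> {0<..<1::real}"
      unfolding image_comp
      by (rule inj_on_image_eqpoll_self)
        (intro inj_on_subset[OF inj_compose[OF inj_bump_series inj_power_seq]] subset_UNIV)
    also have "\<dots> \<approx> (UNIV :: real set)"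
      by (simp add: open_interval_eqpoll_reals)
    finally have G: "?G k \<approx> (UNIV :: real set)" .
    then have "infinite (?G k)"
      using eqpoll_finite_iff infinite_UNIV_char_0 by blast
    from eqpoll_trans[OF infinite_insert_eqpoll[OF this] G]
    show "|insert f (?G k)| =o |UNIV :: real set|"
      by (simp add: eqpoll_def card_of_ordIso)
  qed
  show "\<exists>W :: nat \<Rightarrow> ('a \<Rightarrow> real) set. \<forall>k. subspace (W k) \<and> W k \<subseteq> CinfI \<and>
      has_dimension (W k) |UNIV :: real set| \<and> f \<in> W k \<and> W k \<subseteq> nBCinfI A \<union> {0} \<and>
      (\<forall>l. l \<noteq> k \<longrightarrow> W k \<inter> W l = span {f})"
  proof (intro exI[of _ W] allI conjI impI)
    fix k
    show "subspace (W k)" "f \<in> W k"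
      by (simp_all add: W_def span_base)
    show "has_dimension (W k) |UNIV :: real set|"
      by (rule dimension)
    show sub: "W k \<subseteq> CinfI"
      using f(1) bump_CinfI by (auto simp: W_iff intro!: subspace_add[OF subspace_CinfI]
          subspace_scale[OF subspace_CinfI])
    show "W k \<subseteq> nBCinfI A \<union> {0}"
    proof
      fix w
      assume "w \<in> W k"
      then obtain s c where w: "c \<in> row_space k" "w = s *\<^sub>R f + bump_series c"
        by (auto simp: W_iff)
      have "w = 0" if "bounded (w ` A)"
      proof -
        have "s = 0"
          using f_unbounded that w by blast
        then have "c = 0"
          using bump_unbounded that w by simp
        with \<open>s = 0\<close> show ?thesis
          using w(2) linear_0[OF linear_bump_series] by simp
      qed
      then show "w \<in> nBCinfI A \<union> {0}"
        using sub \<open>w \<in> W k\<close> by (auto simp: nBCinfI_def)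
    qed
    fix l
    assume "l \<noteq> k"
    show "W k \<inter> W l = span {f}"
    proof
      show "span {f} \<subseteq> W k \<inter> W l"
        unfolding W_def using span_mono[of "{f}"] by auto
      show "W k \<inter> W l \<subseteq> span {f}"
      proof
        fix w
        assume "w \<in> W k \<inter> W l"
        then obtain s c s' c' where w: "c \<in> row_space k" "w = s *\<^sub>R f + bump_series c"
          "c' \<in> row_space l" "w = s' *\<^sub>R f + bump_series c'"
          unfolding Int_iff W_iff by blast
        define i where "i = Suc (k + l)"
        have "c (prod_encode (i, 0)) = 0" "c' (prod_encode (i, 0)) = 0"
          using w(1,3) by (auto intro: row_space_off_row simp: i_def)
        then have "s * f (a (prod_encode (i, 0))) = s' * f (a (prod_encode (i, 0)))"
          using fun_cong[OF trans[OF w(2)[symmetric] w(4)], of "a (prod_encode (i, 0))"] by simp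
        then have "s = s'"
          using f_nonzero by simp
        then have "bump_series c = bump_series c'"
          using w(2,4) by simp
        then have "c = c'"
          by (rule injD[OF inj_bump_series])
        then have "c = 0"
          using row_space_Int w(1,3) \<open>l \<noteq> k\<close> by blast
        then show "w \<in> span {f}"
          using w(2) linear_0[OF linear_bump_series] by (simp add: span_scale span_base)
      qed
    qed
  qed
qed

theorem corollary3p4:
  fixes A :: "(real ^ 'n) set"
  assumes "\<not> relatively_compact A"
  shows "infinitely_pointwise_lineable |UNIV :: real set|
    (CinfI :: (real ^ 'n \<Rightarrow> real) set) (nBCinfI A)"
  by (rule infinitely_pointwise_lineable_nBCinfI)

end
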